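(* Let $G$ be a uniquely divisible abelian group, written multiplicatively, and let $I=\mathbb{Q}\cap(0,1)$. Let $\chi:\mathbb{Q}_+^\times\to G$ be a group homomorphism from the multiplicative group of positive rationals. Then the function $w:I\to G$, $$w(\alpha)=\chi(\alpha)^{\alpha}\,\chi(1-\alpha)^{1-\alpha},$$ satisfies $$w(1-\alpha)=w(\alpha)\qquad\text{for all }\alpha\in I,\qquad (\mathrm{A})$$ $$w(\alpha)\,w(\beta)^{\alpha}=w(\alpha\beta)\,w\!\left(\frac{\alpha(1-\beta)}{1-\alpha\beta}\right)^{1-\alpha\beta}\qquad\text{for all }\alpha,\beta\in I.\qquad (\mathrm{B})$$ Moreover, every function $w:I\to G$ satisfying (A) and (B) is of this form for some homomorphism $\chi:\mathbb{Q}_+^\times\to G$.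
   Context: A group $G$ (abelian, written multiplicatively) is uniquely divisible if for every $x\in G$ and every integer $n\ge1$ there is a unique $z\in G$ with $z^n=x$. Then $x^\alpha\in G$ makes sense for every $x\in G$ and every rational $\alpha$: for $\alpha=a/b$ with $b\ge 1$, $x^\alpha$ is the unique $z$ with $z^b=x^a$. *)

theory Defs
  imports Complex_Main "HOL-Algebra.Group"
begin

locale uniquely_divisible_group = comm_group +
  assumes uniquely_divisible:
    "\<And>x n. \<lbrakk>x \<in> carrier G; 1 \<le> (n::int)\<rbrakk> \<Longrightarrow> \<exists>!z. z \<in> carrier G \<and> z [^] n = x"

(* quotient_of picks the representation in lowest terms with positive denominator;
   the lemma rat_pow_eq_iff below shows that any fraction a / b with 1 \<le> b gives the same value. *)
definition rat_pow :: "('a, 'b) monoid_scheme \<Rightarrow> 'a \<Rightarrow> rat \<Rightarrow> 'a"  (infixr \<open>[^\<rat>]\<index>\<close> 75)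
  where "x [^\<rat>]\<^bsub>G\<^esub> q =
    (THE z. z \<in> carrier G \<and> z [^]\<^bsub>G\<^esub> snd (quotient_of q) = x [^]\<^bsub>G\<^esub> fst (quotient_of q))"

definition pos_rat_group :: "rat monoid"
  where "pos_rat_group = \<lparr>carrier = {0<..}, monoid.mult = (*), one = 1\<rparr>"

abbreviation unit_rats :: "rat set"
  where "unit_rats \<equiv> {0<..<1}"

definition w_of :: "('a, 'b) monoid_scheme \<Rightarrow> (rat \<Rightarrow> 'a) \<Rightarrow> rat \<Rightarrow> 'a"
  where "w_of G \<chi> \<alpha> = \<chi> \<alpha> [^\<rat>]\<^bsub>G\<^esub> \<alpha> \<otimes>\<^bsub>G\<^esub> \<chi> (1 - \<alpha>) [^\<rat>]\<^bsub>G\<^esub> (1 - \<alpha>)"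

definition cond_A :: "(rat \<Rightarrow> 'a) \<Rightarrow> bool"
  where "cond_A w \<longleftrightarrow> (\<forall>\<alpha>\<in>unit_rats. w (1 - \<alpha>) = w \<alpha>)"

definition cond_B :: "('a, 'b) monoid_scheme \<Rightarrow> (rat \<Rightarrow> 'a) \<Rightarrow> bool"
  where "cond_B G w \<longleftrightarrow> (\<forall>\<alpha>\<in>unit_rats. \<forall>\<beta>\<in>unit_rats.
    w \<alpha> \<otimes>\<^bsub>G\<^esub> w \<beta> [^\<rat>]\<^bsub>G\<^esub> \<alpha> =
    w (\<alpha> * \<beta>) \<otimes>\<^bsub>G\<^esub> w (\<alpha> * (1 - \<beta>) / (1 - \<alpha> * \<beta>)) [^\<rat>]\<^bsub>G\<^esub> (1 - \<alpha> * \<beta>))"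

lemma comm_group_pos_rat_group: "comm_group pos_rat_group"
proof (rule comm_groupI)
  fix x assume "x \<in> carrier pos_rat_group"
  then show "\<exists>y\<in>carrier pos_rat_group. y \<otimes>\<^bsub>pos_rat_group\<^esub> x = \<one>\<^bsub>pos_rat_group\<^esub>"
    by (intro bexI[of _ "inverse x"]) (auto simp: pos_rat_group_def)
qed (auto simp: pos_rat_group_def mult_ac)

context uniquely_divisible_group
begin

lemma int_pow_cancel:
  assumes "x \<in> carrier G" "y \<in> carrier G" "1 \<le> (n::int)" "x [^] n = y [^] n"
  shows "x = y"
  using uniquely_divisible[of "y [^] n" n] assms by auto

lemma rat_pow_lowest_terms:
  assumes "x \<in> carrier G"
  shows "x [^\<rat>] q \<in> carrier G \<and> (x [^\<rat>] q) [^] snd (quotient_of q) = x [^] fst (quotient_of q)"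
proof -
  have "1 \<le> snd (quotient_of q)"
    using quotient_of_denom_pos'[of q] by simp
  with assms have "\<exists>!z. z \<in> carrier G \<and> z [^] snd (quotient_of q) = x [^] fst (quotient_of q)"
    by (intro uniquely_divisible) auto
  from theI'[OF this] show ?thesis
    unfolding rat_pow_def .
qed

lemma rat_pow_closed [intro, simp]: "x \<in> carrier G \<Longrightarrow> x [^\<rat>] q \<in> carrier G"
  using rat_pow_lowest_terms by blast

lemma rat_pow_eq_iff:
  fixes a b :: int
  assumes x: "x \<in> carrier G" and z: "z \<in> carrier G"
    and b: "1 \<le> b" and q: "q = of_int a / of_int b"
  shows "x [^\<rat>] q = z \<longleftrightarrow> z [^] b = x [^] a"
proof -
  obtain c d where cd: "quotient_of q = (c, d)"
    by fastforce
  define y where "y = x [^\<rat>] q"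
  have y: "y \<in> carrier G" and yd: "y [^] d = x [^] c"
    using rat_pow_lowest_terms[OF x, of q] by (simp_all add: y_def cd)
  have d: "1 \<le> d"
    using quotient_of_denom_pos[OF cd] by simp
  have "rat_of_int (a * d) = of_int (b * c)"
    using quotient_of_div[OF cd] q b d by (simp add: field_simps)
  then have eq: "a * d = b * c"
    by (simp only: of_int_eq_iff)
  have "(y [^] b) [^] d = (y [^] d) [^] b"
    using y by (simp add: int_pow_pow mult.commute)
  also have "\<dots> = (x [^] a) [^] d"
    using x eq yd by (simp add: int_pow_pow mult.commute)
  finally have yb: "y [^] b = x [^] a"
    using int_pow_cancel[OF _ _ d] x y by simp
  show ?thesis
    using int_pow_cancel[OF y z b] yb by (auto simp: y_def)
qed

end

end

theory Submission
  imports Defs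
begin

text \<open>
  Written additively, \<open>G\<close> is a vector space over the rationals and (B) is the fundamental
  equation of information theory.  The idea is to homogenise: put
  \<open>F(a, b) = (a + b) w(a / (a + b))\<close> for positive rational \<open>a, b\<close>.  This is homogeneous of
  degree 1, and, applied to the proportions of a triple \<open>a, b, c\<close>, (B) becomes the 2-cocycle
  identity \<open>F(a + b, c) + F(a, b) = F(a, b + c) + F(b, c)\<close>.  The functions \<open>w\<close> of the required
  form are those for which \<open>F\<close> is the coboundary
  \<open>F(a, b) = h(a) + h(b) - h(a + b)\<close> of \<open>h(t) = t \<chi>(t)\<close>.

  For the direct part, the coboundary formula (\<open>w_of_scaled\<close>) follows from the additivity of
  \<open>\<chi>\<close>, and both sides of (B) then telescope to
  \<open>h(\<alpha>\<beta>) + h(\<alpha>(1 - \<beta>)) + h(1 - \<alpha>)\<close>.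

  For the converse, the positive integers are generated freely by 1, so a cocycle on them is
  always a coboundary: \<open>k(n) = F(1, 1) + F(2, 1) + \<dots> + F(n - 1, 1)\<close> satisfies
  \<open>k(m + n) = k(m) + k(n) + F(m, n)\<close> (\<open>primitive_add\<close>).  Because \<open>F\<close> is homogeneous and
  \<open>k(1) = 0\<close>, this \<open>k\<close> obeys the Leibniz rule \<open>k(m n) = m k(n) + n k(m)\<close>
  (\<open>primitive_mult\<close>).  Therefore \<open>n \<mapsto> - k(n) / n\<close> turns products into sums; its extension
  \<open>\<chi>\<close> to the positive rationals is the homomorphism sought, as evaluating
  \<open>F(m, n - m) = n w(m / n)\<close> shows.
\<close>

section \<open>Rational powers make a uniquely divisible group a rational vector space\<close>

context uniquely_divisible_group
begin

lemma rat_pow_denom: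
  fixes a b :: int
  assumes "x \<in> carrier G" "1 \<le> b"
  shows "(x [^\<rat>] (of_int a / of_int b)) [^] b = x [^] a"
  using rat_pow_eq_iff[OF assms(1) rat_pow_closed[OF assms(1)] assms(2) refl] by blast

lemma rat_fraction_cases:
  fixes q :: rat
  obtains a b :: int where "1 \<le> b" "q = of_int a / of_int b"
proof -
  obtain a b where "quotient_of q = (a, b)" by fastforce
  then show thesis
    using that[of b a] quotient_of_denom_pos quotient_of_div by force
qed

lemma rat_pow_one [simp]: "x \<in> carrier G \<Longrightarrow> x [^\<rat>] 1 = x"
  by (subst rat_pow_eq_iff[where a=1 and b=1]) auto

lemma one_rat_pow [simp]: "\<one> [^\<rat>] q = \<one>"
proof -
  obtain a b :: int where "1 \<le> b" "q = of_int a / of_int b"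
    by (rule rat_fraction_cases)
  then show ?thesis
    by (subst rat_pow_eq_iff[where a=a and b=b]) auto
qed

lemma rat_pow_distrib:
  assumes x: "x \<in> carrier G" and y: "y \<in> carrier G"
  shows "(x \<otimes> y) [^\<rat>] q = x [^\<rat>] q \<otimes> y [^\<rat>] q"
proof -
  obtain a b :: int where b: "1 \<le> b" and q: "q = of_int a / of_int b"
    by (rule rat_fraction_cases)
  have "(x [^\<rat>] q \<otimes> y [^\<rat>] q) [^] b = (x \<otimes> y) [^] a"
    using x y b by (simp add: int_pow_distrib q rat_pow_denom)
  then show ?thesis
    using x y by (subst rat_pow_eq_iff[OF _ _ b q]) auto
qed

lemma rat_pow_add:
  assumes x: "x \<in> carrier G"
  shows "x [^\<rat>] (p + q) = x [^\<rat>] p \<otimes> x [^\<rat>] q"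
proof -
  obtain a b :: int where b: "1 \<le> b" and p: "p = of_int a / of_int b"
    by (rule rat_fraction_cases)
  obtain c d :: int where d: "1 \<le> d" and q: "q = of_int c / of_int d"
    by (rule rat_fraction_cases)
  have 1: "(x [^\<rat>] p) [^] (b * d) = x [^] (a * d)"
    using rat_pow_denom[OF x b, of a] x by (simp add: p flip: int_pow_pow)
  have 2: "(x [^\<rat>] q) [^] (b * d) = x [^] (c * b)"
    using rat_pow_denom[OF x d, of c] x by (simp add: q mult.commute[of b] flip: int_pow_pow)
  have bd: "1 \<le> b * d"
    using b d by (smt (verit) mult_pos_pos)
  have pq: "p + q = of_int (a * d + c * b) / of_int (b * d)"
    using b d by (simp add: p q field_simps)
  show ?thesis
    using x 1 2 by (subst rat_pow_eq_iff[OF _ _ bd pq]) (auto simp: int_pow_distrib int_pow_mult)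
qed

lemma rat_pow_rat_pow:
  assumes x: "x \<in> carrier G"
  shows "(x [^\<rat>] p) [^\<rat>] q = x [^\<rat>] (p * q)"
proof -
  obtain a b :: int where b: "1 \<le> b" and p: "p = of_int a / of_int b"
    by (rule rat_fraction_cases)
  obtain c d :: int where d: "1 \<le> d" and q: "q = of_int c / of_int d"
    by (rule rat_fraction_cases)
  have bd: "1 \<le> b * d"
    using b d by (smt (verit) mult_pos_pos)
  have pq: "p * q = of_int (a * c) / of_int (b * d)"
    by (simp add: p q)
  have "(((x [^\<rat>] p) [^\<rat>] q) [^] d) [^] b = ((x [^\<rat>] p) [^] b) [^] c"
    using x d by (simp add: q rat_pow_denom int_pow_pow mult.commute)
  then have "((x [^\<rat>] p) [^\<rat>] q) [^] (b * d) = x [^] (a * c)"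
    using x b by (simp add: p rat_pow_denom int_pow_pow mult.commute)
  then show ?thesis
    using rat_pow_eq_iff[OF x _ bd pq, of "(x [^\<rat>] p) [^\<rat>] q"] x by simp
qed

lemma rat_pow_minus:
  assumes x: "x \<in> carrier G"
  shows "x [^\<rat>] (- q) = inv (x [^\<rat>] q)"
proof -
  have "x [^\<rat>] (0::rat) = \<one>"
    using rat_pow_eq_iff[OF x one_closed, of 1 0 0] by simp
  then have "x [^\<rat>] (- q) \<otimes> x [^\<rat>] q = \<one>"
    using rat_pow_add[OF x, of "- q" q] by simp
  then show ?thesis
    using x by (simp add: inv_equality)
qed

lemma inv_rat_pow:
  assumes x: "x \<in> carrier G"
  shows "(inv x) [^\<rat>] q = inv (x [^\<rat>] q)"
  using rat_pow_rat_pow[OF x, of "-1" q] x by (simp add: rat_pow_minus)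

section \<open>Homomorphisms give solutions\<close>

text \<open>
  Since \<open>\<chi>\<close> is multiplicative, \<open>\<chi>(t/s)\<^sup>t = \<chi>(t)\<^sup>t \<chi>(s)\<^bsup>-t\<^esup>\<close>.  With \<open>s = a + b\<close> and \<open>t = a\<close>,
  \<open>t = b\<close>, the correction factors combine to \<open>\<chi>(s)\<^sup>s\<close>: the cocycle of \<open>w_of G \<chi>\<close> is the
  coboundary of \<open>t \<mapsto> \<chi>(t)\<^sup>t\<close>.
\<close>

lemma w_of_scaled:
  assumes chi: "\<chi> \<in> hom pos_rat_group G" and a: "0 < a" and b: "0 < b"
  shows "w_of G \<chi> (a / (a + b)) [^\<rat>] (a + b) \<otimes> \<chi> (a + b) [^\<rat>] (a + b)
       = \<chi> a [^\<rat>] a \<otimes> \<chi> b [^\<rat>] b"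
proof -
  define s where "s = a + b"
  have s: "0 < s" using a b by (simp add: s_def)
  have cl: "\<chi> t \<in> carrier G" if "0 < t" for t
    using chi that by (auto simp: hom_def pos_rat_group_def Pi_def)
  have mult: "\<chi> (t * u) = \<chi> t \<otimes> \<chi> u" if "0 < t" "0 < u" for t u
    using chi that by (auto simp: hom_def pos_rat_group_def)
  have split: "\<chi> (t / s) [^\<rat>] t \<otimes> \<chi> s [^\<rat>] t = \<chi> t [^\<rat>] t" if "0 < t" for t
    using mult[of "t / s" s] cl that s by (simp flip: rat_pow_distrib)
  have compl: "1 - a / s = b / s"
    using s by (simp add: s_def field_simps)
  have "w_of G \<chi> (a / s) [^\<rat>] s = \<chi> (a / s) [^\<rat>] a \<otimes> \<chi> (b / s) [^\<rat>] b"
    using cl a b s by (simp add: w_of_def compl rat_pow_distrib rat_pow_rat_pow)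
  moreover have "\<chi> s [^\<rat>] s = \<chi> s [^\<rat>] a \<otimes> \<chi> s [^\<rat>] b"
    using rat_pow_add[OF cl[OF s], of a b] by (simp add: s_def)
  ultimately have "w_of G \<chi> (a / s) [^\<rat>] s \<otimes> \<chi> s [^\<rat>] s
      = (\<chi> (a / s) [^\<rat>] a \<otimes> \<chi> s [^\<rat>] a) \<otimes> (\<chi> (b / s) [^\<rat>] b \<otimes> \<chi> s [^\<rat>] b)"
    using cl a b s by (simp add: m_ac)
  then show ?thesis
    using a b by (simp add: split flip: s_def)
qed

lemma w_of_closed:
  assumes "\<chi> \<in> hom pos_rat_group G"
  shows "w_of G \<chi> \<in> unit_rats \<rightarrow> carrier G"
  using assms by (auto simp: w_of_def hom_def pos_rat_group_def Pi_def)

lemma cond_A_w_of: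
  assumes "\<chi> \<in> hom pos_rat_group G"
  shows "cond_A (w_of G \<chi>)"
  using assms by (auto simp: cond_A_def w_of_def hom_def pos_rat_group_def Pi_def intro!: m_comm)

text \<open>
  Each side of (B) splits off one part from a unit total divided into the three parts
  \<open>\<alpha>\<beta>\<close>, \<open>\<alpha>(1 - \<beta>)\<close>, \<open>1 - \<alpha>\<close> and then divides the remainder.  By the coboundary formula
  the term of the remainder (\<open>h \<alpha>\<close> on the left, \<open>h (1 - \<alpha>\<beta>)\<close> on the right) is
  absorbed, and both sides become the product of \<open>h\<close> over the three parts.
\<close>

lemma cond_B_w_of:
  assumes chi: "\<chi> \<in> hom pos_rat_group G"
  shows "cond_B G (w_of G \<chi>)"
  unfolding cond_B_def
proof (intro ballI)
  fix \<alpha> \<beta> :: rat assume "\<alpha> \<in> unit_rats" "\<beta> \<in> unit_rats"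
  then have a: "0 < \<alpha>" "\<alpha> < 1" and b: "0 < \<beta>" "\<beta> < 1" by auto
  define h where "h t = \<chi> t [^\<rat>] t" for t
  define w where "w = w_of G \<chi>"
  have h: "h t \<in> carrier G" if "0 < t" for t
    using chi that by (auto simp: h_def hom_def pos_rat_group_def Pi_def)
  have ab: "0 < \<alpha> * \<beta>" "\<alpha> * \<beta> < 1" "0 < \<alpha> * (1 - \<beta>)"
    using a b mult_strict_mono[of \<alpha> 1 \<beta> 1] by simp_all
  let ?\<gamma> = "\<alpha> * (1 - \<beta>) / (1 - \<alpha> * \<beta>)"
  have g: "0 < ?\<gamma>" "?\<gamma> < 1"
    using ab a b by (simp_all add: field_simps)
  have w: "w t \<in> carrier G" if "0 < t" "t < 1" for t
    using w_of_closed[OF chi] that by (auto simp: w_def)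
  have wh: "w t = h t \<otimes> h (1 - t)" for t
    by (simp add: w_def w_of_def h_def)
  have "w \<beta> [^\<rat>] \<alpha> \<otimes> h \<alpha> = h (\<alpha> * \<beta>) \<otimes> h (\<alpha> * (1 - \<beta>))"
    using w_of_scaled[OF chi ab(1) ab(3)] a by (simp add: w_def h_def right_diff_distrib)
  moreover have "w \<alpha> \<otimes> w \<beta> [^\<rat>] \<alpha> = (w \<beta> [^\<rat>] \<alpha> \<otimes> h \<alpha>) \<otimes> h (1 - \<alpha>)"
    unfolding wh[of \<alpha>] using h a w b by (simp add: m_ac)
  ultimately have lhs: "w \<alpha> \<otimes> w \<beta> [^\<rat>] \<alpha>
      = h (\<alpha> * \<beta>) \<otimes> h (\<alpha> * (1 - \<beta>)) \<otimes> h (1 - \<alpha>)"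
    by simp
  have "w ?\<gamma> [^\<rat>] (1 - \<alpha> * \<beta>) \<otimes> h (1 - \<alpha> * \<beta>) = h (\<alpha> * (1 - \<beta>)) \<otimes> h (1 - \<alpha>)"
    using w_of_scaled[OF chi ab(3), of "1 - \<alpha>"] a by (simp add: w_def h_def right_diff_distrib)
  moreover have "w (\<alpha> * \<beta>) \<otimes> w ?\<gamma> [^\<rat>] (1 - \<alpha> * \<beta>)
      = h (\<alpha> * \<beta>) \<otimes> (w ?\<gamma> [^\<rat>] (1 - \<alpha> * \<beta>) \<otimes> h (1 - \<alpha> * \<beta>))"
    unfolding wh[of "\<alpha> * \<beta>"] using h ab w[OF g] by (simp add: m_ac)
  ultimately have rhs: "w (\<alpha> * \<beta>) \<otimes> w ?\<gamma> [^\<rat>] (1 - \<alpha> * \<beta>)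
      = h (\<alpha> * \<beta>) \<otimes> h (\<alpha> * (1 - \<beta>)) \<otimes> h (1 - \<alpha>)"
    using h ab a by (simp add: m_assoc)
  show "w_of G \<chi> \<alpha> \<otimes> w_of G \<chi> \<beta> [^\<rat>] \<alpha>
      = w_of G \<chi> (\<alpha> * \<beta>) \<otimes> w_of G \<chi> ?\<gamma> [^\<rat>] (1 - \<alpha> * \<beta>)"
    using lhs rhs by (simp add: w_def)
qed

section \<open>The homogeneous cocycle of a solution\<close>

definition cocycle :: "(rat \<Rightarrow> 'a) \<Rightarrow> rat \<Rightarrow> rat \<Rightarrow> 'a"
  where "cocycle w a b = w (a / (a + b)) [^\<rat>] (a + b)"

lemma cocycle_closed:
  assumes "w \<in> unit_rats \<rightarrow> carrier G" "0 < a" "0 < b"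
  shows "cocycle w a b \<in> carrier G"
  using assms by (auto simp: cocycle_def intro!: rat_pow_closed)

lemma cocycle_homogeneous:
  assumes "w \<in> unit_rats \<rightarrow> carrier G" "0 < a" "0 < b" "0 < t"
  shows "cocycle w (t * a) (t * b) = cocycle w a b [^\<rat>] t"
proof -
  have "w (a / (a + b)) \<in> carrier G"
    using assms by auto
  moreover have "t * a / (t * a + t * b) = a / (a + b)"
    using assms by (simp flip: distrib_left)
  ultimately show ?thesis
    by (simp add: cocycle_def rat_pow_rat_pow algebra_simps)
qed

text \<open>
  This is (B) for \<open>\<alpha> = (a + b)/s\<close> and \<open>\<beta> = a/(a + b)\<close>, where \<open>s = a + b + c\<close>, raised to the
  power \<open>s\<close>: then \<open>\<alpha>\<beta> = a/s\<close>, and the last argument of \<open>w\<close> in (B) is \<open>b/(b + c)\<close>.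
\<close>

lemma cocycle_identity:
  assumes w: "w \<in> unit_rats \<rightarrow> carrier G" and B: "cond_B G w"
    and pos: "0 < a" "0 < b" "0 < c"
  shows "cocycle w (a + b) c \<otimes> cocycle w a b = cocycle w a (b + c) \<otimes> cocycle w b c"
proof -
  define s where "s = a + b + c"
  have s: "0 < s" using pos by (simp add: s_def)
  define \<alpha> \<beta> where "\<alpha> = (a + b) / s" and "\<beta> = a / (a + b)"
  have in01: "\<alpha> \<in> unit_rats" "\<beta> \<in> unit_rats" "a / s \<in> unit_rats" "b / (b + c) \<in> unit_rats"
    using pos by (auto simp: \<alpha>_def \<beta>_def s_def)
  have 1: "\<alpha> * \<beta> = a / s"
    using pos by (simp add: \<alpha>_def \<beta>_def)
  have 2: "1 - a / s = (b + c) / s"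
    using s by (simp add: s_def field_simps)
  have "1 - \<beta> = b / (a + b)"
    using pos by (simp add: \<beta>_def field_simps)
  then have "\<alpha> * (1 - \<beta>) = b / s"
    using pos by (simp add: \<alpha>_def)
  then have 3: "\<alpha> * (1 - \<beta>) / (1 - \<alpha> * \<beta>) = b / (b + c)"
    unfolding 1 2 using s by simp
  have "w \<alpha> \<otimes> w \<beta> [^\<rat>] \<alpha> = w (a / s) \<otimes> w (b / (b + c)) [^\<rat>] ((b + c) / s)"
    using B in01(1,2) unfolding cond_B_def by (metis 1 2 3)
  then have "(w \<alpha> \<otimes> w \<beta> [^\<rat>] \<alpha>) [^\<rat>] s
      = (w (a / s) \<otimes> w (b / (b + c)) [^\<rat>] ((b + c) / s)) [^\<rat>] s"
    by simp
  moreover have "\<And>t. t \<in> unit_rats \<Longrightarrow> w t \<in> carrier G"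
    using w by blast
  ultimately have "w \<alpha> [^\<rat>] s \<otimes> w \<beta> [^\<rat>] (a + b)
      = w (a / s) [^\<rat>] s \<otimes> w (b / (b + c)) [^\<rat>] (b + c)"
    using in01 s by (simp add: rat_pow_distrib rat_pow_rat_pow \<alpha>_def)
  then show ?thesis
    by (simp add: cocycle_def \<alpha>_def \<beta>_def s_def add.assoc)
qed

section \<open>The cocycle is a coboundary on the positive integers\<close>

text \<open>
  A function \<open>k\<close> on the positive integers with \<open>k(m + n) = k(m) k(n) F(m, n)\<close> is determined by
  \<open>k(1)\<close>, which is chosen trivial to make the Leibniz rule below hold without correction term.
  For \<open>w = w_of G \<chi>\<close> it is the inverse of \<open>n \<mapsto> \<chi>(n)\<^sup>n\<close>; this sign keeps inverses out of the
  recursion.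
  The value at 0 is a dummy.
\<close>

primrec primitive :: "(rat \<Rightarrow> 'a) \<Rightarrow> nat \<Rightarrow> 'a"
  where
    "primitive w 0 = \<one>"
  | "primitive w (Suc n) = (if n = 0 then \<one> else primitive w n \<otimes> cocycle w (of_nat n) 1)"

lemma primitive_closed [simp]:
  assumes "w \<in> unit_rats \<rightarrow> carrier G"
  shows "primitive w n \<in> carrier G"
  by (induction n) (auto intro!: cocycle_closed assms)

text \<open>
  The recursion is the case \<open>n = 1\<close>; the cocycle identity for \<open>m, n, 1\<close> carries it from \<open>n\<close> to
  \<open>n + 1\<close>.
\<close>

lemma primitive_add:
  assumes w: "w \<in> unit_rats \<rightarrow> carrier G" and B: "cond_B G w"
    and "0 < m" "0 < n"
  shows "primitive w (m + n)
       = primitive w m \<otimes> primitive w n \<otimes> cocycle w (of_nat m) (of_nat n)"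
  using \<open>0 < n\<close>
proof (induction n rule: nat_induct_non_zero)
  case 1
  then show ?case using w \<open>0 < m\<close> by simp
next
  case (Suc n)
  have m: "0 < rat_of_nat m" and n: "0 < rat_of_nat n"
    using \<open>0 < m\<close> \<open>0 < n\<close> by auto
  note closed = cocycle_closed[OF w]
  have "primitive w (m + Suc n)
      = primitive w m \<otimes> primitive w n
        \<otimes> (cocycle w (of_nat m + of_nat n) 1 \<otimes> cocycle w (of_nat m) (of_nat n))"
    using Suc \<open>0 < m\<close> w m n by (simp add: m_ac closed)
  also have "\<dots> = primitive w m \<otimes> primitive w n
        \<otimes> (cocycle w (of_nat m) (of_nat n + 1) \<otimes> cocycle w (of_nat n) 1)"
    using cocycle_identity[OF w B m n, of 1] by simp
  also have "\<dots> = primitive w m \<otimes> primitive w (Suc n) \<otimes> cocycle w (of_nat m) (of_nat (Suc n))"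
    using Suc.hyps w m n by (simp add: m_ac closed add.commute)
  finally show ?case .
qed

text \<open>
  Induction on \<open>n\<close>: splitting \<open>m (n + 1) = m n + m\<close> costs the factor \<open>F(m n, m)\<close>, which by
  homogeneity is the \<open>m\<close>-th power of the factor \<open>F(n, 1)\<close> separating the primitive at
  \<open>n + 1\<close> from that at \<open>n\<close>.
\<close>

lemma primitive_mult:
  assumes w: "w \<in> unit_rats \<rightarrow> carrier G" and B: "cond_B G w"
    and "0 < m" "0 < n"
  shows "primitive w (m * n)
       = primitive w n [^\<rat>] of_nat m \<otimes> primitive w m [^\<rat>] of_nat n"
  using \<open>0 < n\<close>
proof (induction n rule: nat_induct_non_zero)
  case 1
  then show ?case using w by simp
next
  case (Suc n)
  have m: "0 < rat_of_nat m" and n: "0 < rat_of_nat n"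
    using \<open>0 < m\<close> \<open>0 < n\<close> by auto
  note closed = cocycle_closed[OF w]
  have "primitive w (m * Suc n) = primitive w (m * n + m)"
    by (simp add: add.commute)
  also have "\<dots> = primitive w (m * n) \<otimes> primitive w m
      \<otimes> cocycle w (of_nat m * of_nat n) (of_nat m * 1)"
    using primitive_add[OF w B, of "m * n" m] \<open>0 < m\<close> \<open>0 < n\<close> by simp
  also have "cocycle w (of_nat m * of_nat n) (of_nat m * 1)
      = cocycle w (of_nat n) 1 [^\<rat>] of_nat m"
    by (rule cocycle_homogeneous[OF w n _ m]) simp
  also have "primitive w (m * n) \<otimes> primitive w m \<otimes> \<dots>
      = (primitive w n \<otimes> cocycle w (of_nat n) 1) [^\<rat>] of_nat m
        \<otimes> (primitive w m [^\<rat>] of_nat n \<otimes> primitive w m)"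
    using Suc.IH w n by (simp add: rat_pow_distrib m_ac closed)
  also have "\<dots> = primitive w (Suc n) [^\<rat>] of_nat m \<otimes> primitive w m [^\<rat>] of_nat (Suc n)"
    using Suc.hyps w rat_pow_add[of "primitive w m" "of_nat n" 1] by (simp add: add.commute)
  finally show ?case .
qed

section \<open>Solutions come from homomorphisms\<close>

lemma pos_rat_nat_cases:
  fixes q :: rat
  assumes "0 < q"
  obtains m n :: nat where "0 < m" "0 < n" "q = of_nat m / of_nat n"
proof -
  obtain a b where ab: "quotient_of q = (a, b)" by fastforce
  have "0 < b" using ab by (rule quotient_of_denom_pos)
  moreover have q: "q = of_int a / of_int b" using ab by (rule quotient_of_div)
  ultimately have "0 < a" using assms by (simp add: zero_less_divide_iff)
  then show thesis
    using that[of "nat a" "nat b"] \<open>0 < b\<close> q by simp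
qed

text \<open>
  The multiplicative group of positive rationals is the group of fractions of the positive
  integers under multiplication, so a multiplicative function into a group extends
  to it.
\<close>

lemma multiplicative_extends_to_pos_rat:
  fixes f :: "nat \<Rightarrow> 'a"
  assumes f: "\<And>n. 0 < n \<Longrightarrow> f n \<in> carrier G"
    and mult: "\<And>m n. 0 < m \<Longrightarrow> 0 < n \<Longrightarrow> f (m * n) = f m \<otimes> f n"
  obtains \<chi> where "\<chi> \<in> hom pos_rat_group G"
    and "\<And>m n. 0 < m \<Longrightarrow> 0 < n \<Longrightarrow> \<chi> (of_nat m / of_nat n) = f m \<otimes> inv (f n)"
proof -
  define \<chi> where "\<chi> q = f (nat (fst (quotient_of q))) \<otimes> inv (f (nat (snd (quotient_of q))))" for q
  have val: "\<chi> (of_nat m / of_nat n) = f m \<otimes> inv (f n)" if mn: "0 < m" "0 < n" for m n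
  proof -
    define q :: rat where "q = of_nat m / of_nat n"
    obtain a b where ab: "quotient_of q = (a, b)" by fastforce
    have b: "0 < b" using ab by (rule quotient_of_denom_pos)
    have q: "q = of_int a / of_int b" using ab by (rule quotient_of_div)
    have "0 < q" using mn by (simp add: q_def)
    then have a: "0 < a" using b q by (simp add: zero_less_divide_iff)
    have "rat_of_nat (nat a * n) = of_nat (m * nat b)"
      using q a b mn by (simp add: q_def field_simps)
    then have "nat a * n = m * nat b"
      by (simp only: of_nat_eq_iff)
    then have eq: "f (nat a) \<otimes> f n = f m \<otimes> f (nat b)"
      using mult a b mn by (metis zero_less_nat_eq)
    have cl: "f (nat a) \<in> carrier G" "f (nat b) \<in> carrier G" "f m \<in> carrier G" "f n \<in> carrier G"
      using f a b mn by auto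
    have swap: "x \<otimes> y \<otimes> z \<otimes> y' = x \<otimes> z \<otimes> (y \<otimes> y')"
      if "x \<in> carrier G" "y \<in> carrier G" "z \<in> carrier G" "y' \<in> carrier G" for x y z y'
      using that by (simp add: m_ac)
    have "f (nat a) \<otimes> inv (f (nat b)) = f (nat a) \<otimes> f n \<otimes> inv (f n) \<otimes> inv (f (nat b))"
      using cl by (simp add: m_assoc)
    also have "\<dots> = f m \<otimes> inv (f n) \<otimes> (f (nat b) \<otimes> inv (f (nat b)))"
      unfolding eq using cl by (intro swap inv_closed)
    also have "\<dots> = f m \<otimes> inv (f n)"
      using cl by simp
    finally show ?thesis
      by (simp add: \<chi>_def ab flip: q_def)
  qed
  have "\<chi> \<in> hom pos_rat_group G"
  proof (rule homI)
    fix x assume "x \<in> carrier pos_rat_group"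
    then obtain m n where "0 < m" "0 < n" "x = of_nat m / of_nat n"
      by (auto simp: pos_rat_group_def elim: pos_rat_nat_cases)
    then show "\<chi> x \<in> carrier G" using f val by simp
  next
    fix x y assume "x \<in> carrier pos_rat_group" "y \<in> carrier pos_rat_group"
    then obtain m n k l where x: "0 < m" "0 < n" "x = of_nat m / of_nat n"
      and y: "0 < k" "0 < l" "y = of_nat k / of_nat l"
      by (auto simp: pos_rat_group_def elim!: pos_rat_nat_cases)
    have "\<chi> (x * y) = f (m * k) \<otimes> inv (f (n * l))"
      using val[of "m * k" "n * l"] x y by simp
    then show "\<chi> (x \<otimes>\<^bsub>pos_rat_group\<^esub> y) = \<chi> x \<otimes> \<chi> y"
      using val x y f by (simp add: pos_rat_group_def mult inv_mult m_ac)
  qed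
  then show thesis using val that by blast
qed

text \<open>
  By the Leibniz rule, the root \<open>f(n) = k(n)\<^bsup>-1/n\<^esup>\<close> of the primitive \<open>k\<close> is multiplicative.
  Let \<open>\<chi>\<close> extend it to the positive rationals and let \<open>\<alpha> = m/n\<close>, \<open>l = n - m\<close>.  In \<open>w_of G \<chi> \<alpha>\<close> the
  numerators contribute \<open>k(m)\<^bsup>-1/n\<^esup> k(l)\<^bsup>-1/n\<^esup>\<close>, and the denominators contribute
  \<open>k(n)\<close> to the power \<open>m/n\<^sup>2 + l/n\<^sup>2 = 1/n\<close>.  The product is the \<open>n\<close>-th root of
  \<open>k(n)/(k(m) k(l)) = F(m, l) = w(\<alpha>)\<^sup>n\<close>.
\<close>

lemma solution_is_w_of:
  assumes w: "w \<in> unit_rats \<rightarrow> carrier G" and B: "cond_B G w"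
  obtains \<chi> where "\<chi> \<in> hom pos_rat_group G" "\<And>\<alpha>. \<alpha> \<in> unit_rats \<Longrightarrow> w \<alpha> = w_of G \<chi> \<alpha>"
proof -
  define f where "f n = primitive w n [^\<rat>] (- 1 / of_nat n)" for n
  have closed: "f n \<in> carrier G" for n
    using w by (simp add: f_def)
  have f_pow: "f n [^\<rat>] q = inv (primitive w n [^\<rat>] (q / of_nat n))" for n q
    using w rat_pow_minus[of "primitive w n" "q / of_nat n"] by (simp add: f_def rat_pow_rat_pow)
  have "f (m * n) = f m \<otimes> f n" if "0 < m" "0 < n" for m n
    using w that
    by (simp add: f_def primitive_mult[OF w B] rat_pow_distrib rat_pow_rat_pow m_comm)
  with closed obtain \<chi> where chi: "\<chi> \<in> hom pos_rat_group G"
    and val: "\<And>m n. 0 < m \<Longrightarrow> 0 < n \<Longrightarrow> \<chi> (of_nat m / of_nat n) = f m \<otimes> inv (f n)"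
    by (rule multiplicative_extends_to_pos_rat) auto
  have "w \<alpha> = w_of G \<chi> \<alpha>" if "\<alpha> \<in> unit_rats" for \<alpha>
  proof -
    have "0 < \<alpha>" "\<alpha> < 1" using that by auto
    then obtain m n where mn: "0 < m" "0 < n" and \<alpha>: "\<alpha> = of_nat m / of_nat n"
      by (blast elim: pos_rat_nat_cases)
    with \<open>\<alpha> < 1\<close> have "m < n" by simp
    define l where "l = n - m"
    have l: "0 < l" "n = m + l" using \<open>m < n\<close> by (auto simp: l_def)
    have \<alpha>': "1 - \<alpha> = of_nat l / of_nat n"
      using mn by (simp add: \<alpha> l(2) field_simps)
    define k where "k = primitive w"
    define r :: rat where "r = 1 / of_nat n"
    have k: "k i \<in> carrier G" for i using w by (simp add: k_def)
    have w\<alpha>: "w \<alpha> \<in> carrier G" using w that by auto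
    have "cocycle w (of_nat m) (of_nat l) = w \<alpha> [^\<rat>] of_nat n"
      by (simp add: cocycle_def \<alpha> l(2))
    then have "k n = k m \<otimes> k l \<otimes> w \<alpha> [^\<rat>] of_nat n"
      using primitive_add[OF w B mn(1) l(1)] by (simp add: k_def l(2))
    then have "k n [^\<rat>] r = (k m \<otimes> k l \<otimes> w \<alpha> [^\<rat>] of_nat n) [^\<rat>] r"
      by simp
    also have "\<dots> = k m [^\<rat>] r \<otimes> k l [^\<rat>] r \<otimes> w \<alpha>"
      using k w\<alpha> mn by (simp add: rat_pow_distrib rat_pow_rat_pow r_def)
    finally have kn: "k n [^\<rat>] r = k m [^\<rat>] r \<otimes> k l [^\<rat>] r \<otimes> w \<alpha>" .
    have part: "\<chi> (of_nat i / of_nat n) [^\<rat>] (of_nat i / of_nat n)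
        = inv (k i [^\<rat>] r) \<otimes> k n [^\<rat>] (of_nat i / of_nat n * r)" if "0 < i" for i
      using that mn k closed
      by (simp add: val rat_pow_distrib inv_rat_pow f_pow r_def flip: k_def)
    have "of_nat m / of_nat n + of_nat l / of_nat n = (1::rat)"
      using mn by (simp add: l(2) flip: add_divide_distrib)
    then have "r = of_nat m / of_nat n * r + of_nat l / of_nat n * r"
      by (metis distrib_right mult_1)
    then have split: "k n [^\<rat>] r = k n [^\<rat>] (of_nat m / of_nat n * r) \<otimes> k n [^\<rat>] (of_nat l / of_nat n * r)"
      by (metis k rat_pow_add)
    have "w_of G \<chi> \<alpha> = (inv (k m [^\<rat>] r) \<otimes> k n [^\<rat>] (of_nat m / of_nat n * r))
        \<otimes> (inv (k l [^\<rat>] r) \<otimes> k n [^\<rat>] (of_nat l / of_nat n * r))"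
      unfolding w_of_def \<alpha>' by (simp add: \<alpha> part mn l(1))
    also have "\<dots> = inv (k m [^\<rat>] r) \<otimes> inv (k l [^\<rat>] r) \<otimes> k n [^\<rat>] r"
      unfolding split using k by (simp add: m_ac)
    also have "\<dots> = (inv (k m [^\<rat>] r) \<otimes> k m [^\<rat>] r) \<otimes> (inv (k l [^\<rat>] r) \<otimes> k l [^\<rat>] r) \<otimes> w \<alpha>"
      unfolding kn using k w\<alpha> by (simp add: m_ac del: l_inv r_inv)
    also have "\<dots> = w \<alpha>"
      using k w\<alpha> by simp
    finally show ?thesis by simp
  qed
  with chi that show thesis by blast
qed

end

theorem theorem5p2:
  fixes G :: "('a, 'b) monoid_scheme"
  assumes "uniquely_divisible_group G"
  shows "(\<forall>\<chi> \<in> hom pos_rat_group G.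
            w_of G \<chi> \<in> unit_rats \<rightarrow> carrier G \<and> cond_A (w_of G \<chi>) \<and> cond_B G (w_of G \<chi>)) \<and>
         (\<forall>w \<in> unit_rats \<rightarrow> carrier G. cond_A w \<and> cond_B G w \<longrightarrow>
            (\<exists>\<chi> \<in> hom pos_rat_group G. \<forall>\<alpha>\<in>unit_rats. w \<alpha> = w_of G \<chi> \<alpha>))"
proof -
  interpret uniquely_divisible_group G by (fact assms)
  show ?thesis
    using w_of_closed cond_A_w_of cond_B_w_of solution_is_w_of by metis
qed

end
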